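(* a) If $\widehat X\subseteq\widehat{\mathbb{R}}$, $\widehat{\mathbf B}$ is a base for a topology for $\widehat X$ and a collection of monads of subsets of $\mathbb{R}$, and $\mathbf B:=\{\sigma(\widehat A)\mid\widehat A\in\widehat{\mathbf B}\}$, then $\mathbf B$ is a base for a topology for $\sigma(\widehat X)$. In b)–e), let $\widehat{\mathbf T}$ be a topology for $\widehat{\mathbb{R}}$ that is a collection of monads of subsets of $\mathbb{R}$, and let $\mathbf T:=\{\sigma(\widehat A)\mid\widehat A\in\widehat{\mathbf T}\}$. b) $\mathbf T$ is a topology for $\mathbb{R}$. c) If $\widehat X$ is the monad of a subset of $\mathbb{R}$, then $$\mathrm{int}_{\mathbf T}\sigma(\widehat X)=\sigma(\mathrm{int}_{\widehat{\mathbf T}}\widehat X),\quad\mathrm{ext}_{\mathbf T}\sigma(\widehat X)=\sigma(\mathrm{ext}_{\widehat{\mathbf T}}\widehat X),$$ $$\mathrm{bd}_{\mathbf T}\sigma(\widehat X)=\sigma(\mathrm{bd}_{\widehat{\mathbf T}}\widehat X),\quad\mathrm{cl}_{\mathbf T}\sigma(\widehat X)=\sigma(\mathrm{cl}_{\widehat{\mathbf T}}\widehat X);$$ and $\sigma(\widehat X)$ is open (respectively closed, compact) for $\mathbf T$ if and only if $\widehat X$ is open (respectively closed, compact) for $\widehat{\mathbf T}$. d) If $\widehat Y\subseteq\widehat X\subseteq\widehat{\mathbb{R}}$, and $\widehat X$ and $\widehat Y$ are monads of subsets of $\widehat{\mathbb{R}}$, then $\mathbf T_{\sigma(\widehat X)}=\{\sigma(\widehat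 A)\mid\widehat A\in\widehat{\mathbf T}_{\widehat X}\}$ and $\mathrm{cl}_{\mathbf T_{\sigma(\widehat X)}}\sigma(\widehat Y)=\sigma(\mathrm{cl}_{\widehat{\mathbf T}_{\widehat X}}\widehat Y)$, where $\widehat{\mathbf T}_{\widehat X}$ and $\mathbf T_{\sigma(\widehat X)}$ are the relativizations of $\widehat{\mathbf T}$ and $\mathbf T$ to $\widehat X$ and $\sigma(\widehat X)$, respectively. e) If $\widehat X$ is the monad of a subset of $\mathbb{R}$, then $\sigma(\widehat X)$ is connected for $\mathbf T$ if and only if $\widehat X$ is connected for $\widehat{\mathbf T}$. f) If $\widehat{\mathbf B}$ is a $\sigma$-algebra of subsets of $\widehat{\mathbb{R}}$ and a collection of monads of subsets of $\mathbb{R}$, and $\mathbf B:=\{\sigma(\widehat A)\mid\widehat A\in\widehat{\mathbf B}\}$, then $\mathbf B$ is a $\sigma$-algebra of subsets of $\mathbb{R}$.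
   Context: $\widehat{\mathbb{R}}$ is the set of all convergent sequences of real numbers; a real number is identified with the corresponding constant sequence, so $\mathbb{R}\subseteq\widehat{\mathbb{R}}$. $\sigma x\in\mathbb{R}$ is the limit of $x$, and $x\approx y$ means $\sigma x=\sigma y$. For $\widehat A\subseteq\widehat{\mathbb{R}}$, the monad of $\widehat A$ is $m_{\approx}(\widehat A):=\{x\in\widehat{\mathbb{R}}\mid(\exists y\in\widehat A)\,x\approx y\}$ and the shadow of $\widehat A$ is $\sigma(\widehat A):=\{\sigma x\mid x\in\widehat A\}\subseteq\mathbb{R}$. $\mathrm{int},\mathrm{ext},\mathrm{bd},\mathrm{cl}$ denote interior, exterior (interior of the complement), boundary and closure for the topology in the subscript. *)

theory Defs
  imports "HOL-Analysis.Analysis"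
begin

definition hatR :: "(nat \<Rightarrow> real) set" where
  "hatR = {x. convergent x}"

definition const_seq :: "real \<Rightarrow> nat \<Rightarrow> real" where
  "const_seq r = (\<lambda>_. r)"

text \<open>\<^term>\<open>lim x\<close> is meaningful only for convergent \<open>x\<close>, so \<open>approx\<close> and \<open>shadow\<close> are to be
  used for elements and subsets of \<^const>\<open>hatR\<close> only.\<close>

definition approx :: "(nat \<Rightarrow> real) \<Rightarrow> (nat \<Rightarrow> real) \<Rightarrow> bool" where
  "approx x y \<longleftrightarrow> lim x = lim y"

definition monad :: "(nat \<Rightarrow> real) set \<Rightarrow> (nat \<Rightarrow> real) set" where
  "monad A = {x \<in> hatR. \<exists>y\<in>A. approx x y}"

definition shadow :: "(nat \<Rightarrow> real) set \<Rightarrow> real set" where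
  "shadow A = {lim x |x. x \<in> A}"

text \<open>A set of reals is viewed as a subset of \<^const>\<open>hatR\<close> through \<^const>\<open>const_seq\<close>.\<close>

definition monads_of_real_sets :: "(nat \<Rightarrow> real) set set" where
  "monads_of_real_sets = {monad (const_seq ` S) |S. S \<subseteq> (UNIV :: real set)}"

definition monads_of_hat_sets :: "(nat \<Rightarrow> real) set set" where
  "monads_of_hat_sets = {monad S |S. S \<subseteq> hatR}"

definition shadows :: "(nat \<Rightarrow> real) set set \<Rightarrow> real set set" where
  "shadows C = {shadow A |A. A \<in> C}"

definition is_topology_for :: "'a set set \<Rightarrow> 'a set \<Rightarrow> bool" where
  "is_topology_for C X \<longleftrightarrow> istopology (\<lambda>U. U \<in> C) \<and> \<Union>C = X"

text \<open>By \<open>topology_inverse'\<close>, the members of \<open>C\<close> are exactly the open sets of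
  \<open>topology_of C\<close> whenever \<open>C\<close> is a topology for some set; otherwise the value is unspecified.\<close>

definition topology_of :: "'a set set \<Rightarrow> 'a topology" where
  "topology_of C = topology (\<lambda>U. U \<in> C)"

definition is_base_for_topology_for :: "'a set set \<Rightarrow> 'a set \<Rightarrow> bool" where
  "is_base_for_topology_for B X \<longleftrightarrow>
     (\<exists>T. topspace T = X \<and> openin T = arbitrary union_of (\<lambda>U. U \<in> B))"

definition exterior_of :: "'a topology \<Rightarrow> 'a set \<Rightarrow> 'a set" (infixr \<open>exterior'_of\<close> 80) where
  "X exterior_of S = X interior_of (topspace X - S)"

end

(* Monads of sets of reals are exactly the lim-saturated subsets of hatR, that is, the preimages
   of sets of reals under lim. Since lim maps hatR onto the reals, taking preimages is injective
   and commutes with unions, intersections and complements, and the shadow is its inverse.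
   Hence hT is the topology pulled back from T along lim, and every notion defined by
   Boolean operations and unions of open sets transfers. *)
theory Submission
  imports Defs
begin

section \<open>Saturated sets of convergent sequences\<close>

text \<open>\<open>lim\<close> is total and has unspecified values on divergent sequences;
  intersecting with \<open>hatR\<close> keeps these out of the preimage.\<close>

definition lim_vimage :: "real set \<Rightarrow> (nat \<Rightarrow> real) set" where
  "lim_vimage S = {x \<in> hatR. lim x \<in> S}"

lemma lim_const_seq [simp]: "lim (const_seq r) = r"
  by (simp add: const_seq_def)

lemma const_seq_in_lim_vimage [simp]: "const_seq r \<in> lim_vimage S \<longleftrightarrow> r \<in> S"
  by (simp add: lim_vimage_def hatR_def) (simp add: const_seq_def convergent_const)

lemma lim_vimage_UNIV [simp]: "lim_vimage UNIV = hatR"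
  by (simp add: lim_vimage_def)

lemma lim_vimage_empty [simp]: "lim_vimage {} = {}"
  by (simp add: lim_vimage_def)

lemma lim_vimage_subset_hatR [simp]: "lim_vimage S \<subseteq> hatR"
  by (auto simp: lim_vimage_def)

lemma lim_vimage_Int: "lim_vimage (S \<inter> S') = lim_vimage S \<inter> lim_vimage S'"
  by (auto simp: lim_vimage_def)

lemma lim_vimage_Un: "lim_vimage (S \<union> S') = lim_vimage S \<union> lim_vimage S'"
  by (auto simp: lim_vimage_def)

lemma lim_vimage_Diff: "lim_vimage (S - S') = lim_vimage S - lim_vimage S'"
  by (auto simp: lim_vimage_def)

lemma lim_vimage_Union: "lim_vimage (\<Union>\<S>) = \<Union>(lim_vimage ` \<S>)"
  by (auto simp: lim_vimage_def)

text \<open>Each real is the limit of its constant sequence, so a set of reals can be read off from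
  its preimage. Injectivity of \<open>lim_vimage\<close> rests on this.\<close>

lemma lim_vimage_subset_iff [simp]: "lim_vimage S \<subseteq> lim_vimage S' \<longleftrightarrow> S \<subseteq> S'"
proof
  assume "lim_vimage S \<subseteq> lim_vimage S'"
  then have "const_seq r \<in> lim_vimage S \<Longrightarrow> const_seq r \<in> lim_vimage S'" for r
    by blast
  then show "S \<subseteq> S'" by auto
qed (auto simp: lim_vimage_def)

lemma inj_lim_vimage: "inj lim_vimage"
  by (rule injI) (metis lim_vimage_subset_iff subset_antisym subset_refl)

lemma lim_vimage_eq_iff [simp]: "lim_vimage S = lim_vimage S' \<longleftrightarrow> S = S'"
  by (rule inj_eq [OF inj_lim_vimage])

lemma lim_vimage_eq_empty_iff [simp]: "lim_vimage S = {} \<longleftrightarrow> S = {}"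
  using lim_vimage_eq_iff [of S "{}"] by simp

lemma shadow_eq_image: "shadow A = lim ` A"
  by (auto simp: shadow_def)

lemma shadow_lim_vimage [simp]: "shadow (lim_vimage S) = S"
proof
  show "S \<subseteq> shadow (lim_vimage S)"
  proof
    fix r assume "r \<in> S"
    then show "r \<in> shadow (lim_vimage S)"
      by (intro shadow_eq_image [THEN equalityD2, THEN subsetD] image_eqI [of _ _ "const_seq r"]) simp_all
  qed
qed (auto simp: shadow_def lim_vimage_def)

text \<open>\<open>approx\<close> compares limits only, so a monad depends on its set only through
  the shadow.\<close>

lemma monad_eq_lim_vimage: "monad A = lim_vimage (shadow A)"
  by (auto simp: monad_def approx_def lim_vimage_def shadow_def)

lemma shadow_const_seq_image [simp]: "shadow (const_seq ` S) = S"
  by (simp add: shadow_eq_image image_image)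

lemma monads_of_real_sets_eq: "monads_of_real_sets = range lim_vimage"
  by (auto simp: monads_of_real_sets_def monad_eq_lim_vimage)

text \<open>A saturated set is its own monad, so monads of subsets of \<open>hatR\<close> give the
  same sets as monads of sets of reals.\<close>

lemma monads_of_hat_sets_eq: "monads_of_hat_sets = range lim_vimage"
proof -
  have "lim_vimage S = monad (lim_vimage S)" for S
    by (simp add: monad_eq_lim_vimage)
  then have "range lim_vimage \<subseteq> monads_of_hat_sets"
    unfolding monads_of_hat_sets_def using lim_vimage_subset_hatR by blast
  then show ?thesis
    by (intro subset_antisym) (auto simp: monads_of_hat_sets_def monad_eq_lim_vimage)
qed

section \<open>Collections of saturated sets: bases and sigma-algebras\<close>

text \<open>Replaces the image under \<open>shadow\<close> by a preimage condition, through which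
  closure properties of \<open>\<A>\<close> carry over. Saturation is what recovers a member of
  \<open>\<A>\<close> from its shadow.\<close>

lemma mem_shadows_iff:
  assumes "\<A> \<subseteq> range lim_vimage"
  shows "S \<in> shadows \<A> \<longleftrightarrow> lim_vimage S \<in> \<A>"
proof
  assume "S \<in> shadows \<A>"
  with assms show "lim_vimage S \<in> \<A>"
    by (auto simp: shadows_def)
next
  assume "lim_vimage S \<in> \<A>"
  then have "shadow (lim_vimage S) \<in> shadows \<A>"
    unfolding shadows_def by blast
  then show "S \<in> shadows \<A>" by simp
qed

lemma lim_vimage_image_shadows:
  assumes "\<A> \<subseteq> range lim_vimage"
  shows "lim_vimage ` shadows \<A> = \<A>"
proof -
  have "lim_vimage (shadow A) = A" if "A \<in> \<A>" for A
    using that assms by auto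
  then show ?thesis
    by (simp add: shadows_def Setcompr_eq_image image_image)
qed

lemma istopology_lim_vimage:
  assumes "istopology openp"
  shows "istopology (\<lambda>S. openp (lim_vimage S))"
  using assms unfolding istopology_def
  by (auto simp: lim_vimage_Int lim_vimage_Union)

lemma Union_range_lim_vimage:
  assumes "\<A> \<subseteq> range lim_vimage"
  shows "\<Union>\<A> = lim_vimage (\<Union>(shadows \<A>))"
  by (simp add: lim_vimage_Union lim_vimage_image_shadows [OF assms])

text \<open>Subfamilies of \<open>shadows \<B>\<close> and of \<open>\<B>\<close> correspond through
  \<open>lim_vimage\<close> and \<open>shadows\<close>, and unions are respected both ways.\<close>

lemma union_of_shadows:
  assumes "\<B> \<subseteq> range lim_vimage"
  shows "(arbitrary union_of (\<lambda>U. U \<in> shadows \<B>)) S \<longleftrightarrow>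
         (arbitrary union_of (\<lambda>U. U \<in> \<B>)) (lim_vimage S)" (is "?L \<longleftrightarrow> ?R")
proof
  assume ?L
  then obtain \<U> where "\<U> \<subseteq> shadows \<B>" "\<Union>\<U> = S"
    by (auto simp: union_of_def arbitrary_def)
  then have "lim_vimage ` \<U> \<subseteq> \<B>" "\<Union>(lim_vimage ` \<U>) = lim_vimage S"
    using assms by (auto simp: mem_shadows_iff simp flip: lim_vimage_Union)
  then show ?R
    by (auto simp: union_of_def arbitrary_def)
next
  assume ?R
  then obtain \<U> where \<U>: "\<U> \<subseteq> \<B>" "\<Union>\<U> = lim_vimage S"
    by (auto simp: union_of_def arbitrary_def)
  \<comment> \<open>Both \<open>S\<close> and the union of the shadows have preimage
    \<open>\<Union>\<U>\<close>, so injectivity of \<open>lim_vimage\<close> identifies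
    them.\<close>
  with Union_range_lim_vimage [of \<U>] assms have "\<Union>(shadows \<U>) = S"
    by auto
  moreover have "shadows \<U> \<subseteq> shadows \<B>"
    using \<U> by (auto simp: shadows_def)
  ultimately show ?L
    by (auto simp: union_of_def arbitrary_def)
qed

text \<open>The unions of members of \<open>shadows \<B>\<close> are the sets whose preimage is open
  in the topology with base \<open>\<B>\<close>, hence they form a topology.\<close>

lemma base_shadows:
  assumes "is_base_for_topology_for \<B> X" and \<B>: "\<B> \<subseteq> range lim_vimage"
  shows "is_base_for_topology_for (shadows \<B>) (shadow X)"
proof -
  let ?p = "arbitrary union_of (\<lambda>U. U \<in> \<B>)"
  let ?q = "arbitrary union_of (\<lambda>U. U \<in> shadows \<B>)"
  obtain T where T: "topspace T = X" "openin T = ?p"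
    using assms by (auto simp: is_base_for_topology_for_def)
  have "istopology ?p"
    using istopology_openin [of T] T by simp
  then have "istopology (\<lambda>S. ?p (lim_vimage S))"
    by (rule istopology_lim_vimage)
  then have "istopology ?q"
    by (simp add: union_of_shadows [OF \<B>, abs_def])
  then have open_q: "openin (topology ?q) = ?q"
    by (rule topology_inverse')
  have "?p X"
    using T openin_topspace by metis
  then obtain \<U> where \<U>: "\<U> \<subseteq> \<B>" "\<Union>\<U> = X"
    by (auto simp: union_of_def arbitrary_def)
  \<comment> \<open>Saturation of \<open>X\<close> is not assumed: it follows because the whole
    space is a union of members of \<open>\<B>\<close>.\<close>
  then have X: "X = lim_vimage (shadow X)"
    using Union_range_lim_vimage [of \<U>] \<B> by auto
  have "topspace (topology ?q) = shadow X"
  proof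
    show "shadow X \<subseteq> topspace (topology ?q)"
      using \<open>?p X\<close> X by (intro openin_subset) (simp add: open_q union_of_shadows [OF \<B>])
    have "?p (lim_vimage (topspace (topology ?q)))"
      using openin_topspace [of "topology ?q"] by (simp add: open_q union_of_shadows [OF \<B>])
    then have "lim_vimage (topspace (topology ?q)) \<subseteq> lim_vimage (shadow X)"
      using T X openin_subset by metis
    then show "topspace (topology ?q) \<subseteq> shadow X" by simp
  qed
  with open_q show ?thesis
    unfolding is_base_for_topology_for_def by blast
qed

text \<open>Since \<open>hatR\<close> is the preimage of \<open>UNIV\<close>, complements match on
  both sides, and preimages commute with countable unions.\<close>

lemma sigma_algebra_shadows:
  assumes "sigma_algebra hatR \<B>" and \<B>: "\<B> \<subseteq> range lim_vimage"
  shows "sigma_algebra UNIV (shadows \<B>)"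
proof -
  interpret sigma_algebra hatR \<B> by fact
  show ?thesis
    unfolding sigma_algebra_iff2
  proof (intro conjI ballI allI impI)
    show "{} \<in> shadows \<B>"
      by (simp add: mem_shadows_iff [OF \<B>])
    show "UNIV - S \<in> shadows \<B>" if "S \<in> shadows \<B>" for S
      using that by (simp add: mem_shadows_iff [OF \<B>] lim_vimage_Diff compl_sets)
    show "(\<Union>i. A i) \<in> shadows \<B>" if "range A \<subseteq> shadows \<B>" for A :: "nat \<Rightarrow> real set"
    proof -
      have "lim_vimage (A i) \<in> \<B>" for i
        using that by (auto simp flip: mem_shadows_iff [OF \<B>])
      then have "(\<Union>i. lim_vimage (A i)) \<in> \<B>" by auto
      then show ?thesis
        by (simp add: mem_shadows_iff [OF \<B>] lim_vimage_Union image_image)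
    qed
  qed simp
qed

section \<open>Transfer along the topology pulled back by \<open>lim\<close>\<close>

locale lim_pullback =
  fixes T :: "real topology" and hT :: "(nat \<Rightarrow> real) topology"
  assumes topspace_T [simp]: "topspace T = UNIV"
    and openin_hT: "openin hT A \<longleftrightarrow> (\<exists>S. openin T S \<and> A = lim_vimage S)"
begin

lemma openin_lim_vimage_iff [simp]: "openin hT (lim_vimage S) \<longleftrightarrow> openin T S"
  by (auto simp: openin_hT)

lemma topspace_hT [simp]: "topspace hT = hatR"
proof
  show "hatR \<subseteq> topspace hT"
    using openin_lim_vimage_iff [of UNIV] openin_topspace [of T] openin_subset [of hT] by simp
  show "topspace hT \<subseteq> hatR"
    using openin_topspace [of hT] lim_vimage_subset_hatR unfolding openin_hT by metis
qed

lemma closedin_lim_vimage_iff [simp]: "closedin hT (lim_vimage S) \<longleftrightarrow> closedin T S"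
  using openin_lim_vimage_iff [of "UNIV - S"]
  by (simp add: closedin_def lim_vimage_Diff)

text \<open>Open sets of \<open>hT\<close> are saturated, so an open subset of
  \<open>lim_vimage S\<close> is \<open>lim_vimage U\<close> for some open
  \<open>U \<subseteq> S\<close>.\<close>

lemma interior_of_lim_vimage: "hT interior_of lim_vimage S = lim_vimage (T interior_of S)"
proof (rule interior_of_unique)
  fix A assume "A \<subseteq> lim_vimage S" "openin hT A"
  then show "A \<subseteq> lim_vimage (T interior_of S)"
    unfolding openin_hT by (metis interior_of_maximal lim_vimage_subset_iff)
qed (simp_all add: interior_of_subset)

lemma exterior_of_lim_vimage: "hT exterior_of lim_vimage S = lim_vimage (T exterior_of S)"
  using interior_of_lim_vimage [of "UNIV - S"] by (simp add: exterior_of_def lim_vimage_Diff)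

lemma closure_of_lim_vimage: "hT closure_of lim_vimage S = lim_vimage (T closure_of S)"
  using interior_of_lim_vimage [of "UNIV - S"]
  by (simp add: closure_of_interior_of lim_vimage_Diff)

lemma frontier_of_lim_vimage: "hT frontier_of lim_vimage S = lim_vimage (T frontier_of S)"
  by (simp add: frontier_of_def closure_of_lim_vimage interior_of_lim_vimage lim_vimage_Diff)

text \<open>In one direction \<open>S\<close> is a continuous image; in the other, every open cover
  in \<open>hT\<close> consists of preimages of a cover of \<open>S\<close>.\<close>

lemma compactin_lim_vimage_iff: "compactin hT (lim_vimage S) \<longleftrightarrow> compactin T S"
proof
  assume L: "compactin hT (lim_vimage S)"
  have "continuous_map hT T lim"
    by (simp add: continuous_map openin_lim_vimage_iff [unfolded lim_vimage_def])
  with L have "compactin T (lim ` lim_vimage S)"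
    by (rule image_compactin)
  moreover have "lim ` lim_vimage S = S"
    by (simp flip: shadow_eq_image)
  ultimately show "compactin T S" by simp
next
  assume R: "compactin T S"
  show "compactin hT (lim_vimage S)"
    unfolding compactin_def
  proof (intro conjI allI impI)
    fix \<U> assume \<U>: "Ball \<U> (openin hT) \<and> lim_vimage S \<subseteq> \<Union>\<U>"
    then have "\<U> \<subseteq> lim_vimage ` Collect (openin T)"
      by (auto simp: openin_hT)
    then obtain \<V> where \<V>: "\<V> \<subseteq> Collect (openin T)" "\<U> = lim_vimage ` \<V>"
      by (auto simp: subset_image_iff)
    with \<U> have "S \<subseteq> \<Union>\<V>"
      by (simp flip: lim_vimage_Union)
    with R \<V>(1) have "\<exists>\<F>. finite \<F> \<and> \<F> \<subseteq> \<V> \<and> S \<subseteq> \<Union>\<F>"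
      by (intro compactinD) auto
    then obtain \<F> where "finite \<F>" "\<F> \<subseteq> \<V>" "S \<subseteq> \<Union>\<F>"
      by blast
    with \<V>(2) show "\<exists>\<F>. finite \<F> \<and> \<F> \<subseteq> \<U> \<and> lim_vimage S \<subseteq> \<Union>\<F>"
      by (intro exI [of _ "lim_vimage ` \<F>"]) (auto simp flip: lim_vimage_Union)
  qed simp
qed

text \<open>The open sets of a separation are themselves preimages; what remains are inclusions and
  emptiness conditions, which \<open>lim_vimage\<close> preserves and reflects.\<close>

lemma connectedin_lim_vimage_iff: "connectedin hT (lim_vimage S) \<longleftrightarrow> connectedin T S"
proof -
  have "(\<exists>A B. openin hT A \<and> openin hT B \<and> lim_vimage S \<subseteq> A \<union> B \<and>
           A \<inter> B \<inter> lim_vimage S = {} \<and> A \<inter> lim_vimage S \<noteq> {} \<and> B \<inter> lim_vimage S \<noteq> {}) \<longleftrightarrow>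
        (\<exists>U V. openin T U \<and> openin T V \<and> lim_vimage S \<subseteq> lim_vimage U \<union> lim_vimage V \<and>
           lim_vimage U \<inter> lim_vimage V \<inter> lim_vimage S = {} \<and>
           lim_vimage U \<inter> lim_vimage S \<noteq> {} \<and> lim_vimage V \<inter> lim_vimage S \<noteq> {})"
    unfolding openin_hT by blast
  then show ?thesis
    unfolding connectedin by (simp flip: lim_vimage_Int lim_vimage_Un)
qed

text \<open>Relatively open sets are the preimages of the sets \<open>U \<inter> S\<close> with
  \<open>U\<close> open in \<open>T\<close>, so the relativized topology again consists of saturated
  sets.\<close>

lemma openin_subtopology_shadows:
  "{U. openin (subtopology T S) U} = shadows {A. openin (subtopology hT (lim_vimage S)) A}"
proof -
  have "openin (subtopology hT (lim_vimage S)) A \<longleftrightarrow>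
        (\<exists>U. openin T U \<and> A = lim_vimage (U \<inter> S))" for A
    unfolding openin_subtopology openin_hT lim_vimage_Int by blast
  then have *: "{A. openin (subtopology hT (lim_vimage S)) A} =
        lim_vimage ` {U. openin (subtopology T S) U}"
    by (auto simp: openin_subtopology inj_image_mem_iff [OF inj_lim_vimage])
  show ?thesis
    unfolding * by (auto simp: mem_shadows_iff [OF image_mono [OF subset_UNIV]])
qed

lemma closure_of_subtopology_lim_vimage:
  "subtopology hT (lim_vimage S) closure_of lim_vimage S' =
   lim_vimage (subtopology T S closure_of S')"
  by (simp add: closure_of_subtopology closure_of_lim_vimage flip: lim_vimage_Int)

end

section \<open>From collections of monads to the pulled-back topology\<close>

lemma topology_shadows:
  assumes "is_topology_for \<A> hatR" and \<A>: "\<A> \<subseteq> range lim_vimage"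
  shows "is_topology_for (shadows \<A>) UNIV"
    and "lim_pullback (topology_of (shadows \<A>)) (topology_of \<A>)"
proof -
  have ist: "istopology (\<lambda>U. U \<in> \<A>)" and Un: "\<Union>\<A> = hatR"
    using assms by (auto simp: is_topology_for_def)
  have ist': "istopology (\<lambda>U. U \<in> shadows \<A>)"
    using istopology_lim_vimage [OF ist] by (simp add: mem_shadows_iff [OF \<A>])
  \<comment> \<open>Both sides have preimage \<open>hatR\<close>.\<close>
  have Un': "\<Union>(shadows \<A>) = UNIV"
    using Union_range_lim_vimage [OF \<A>] Un lim_vimage_UNIV by (metis lim_vimage_eq_iff)
  show "is_topology_for (shadows \<A>) UNIV"
    by (simp add: is_topology_for_def ist' Un')
  \<comment> \<open>\<open>topology_of\<close> is specified only for genuine topologies, so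
    \<open>ist\<close> and \<open>ist'\<close> are needed to identify open sets with
    members.\<close>
  have open_hT: "openin (topology_of \<A>) A \<longleftrightarrow> A \<in> \<A>" for A
    by (simp add: topology_of_def topology_inverse' [OF ist])
  have open_T: "openin (topology_of (shadows \<A>)) S \<longleftrightarrow> S \<in> shadows \<A>" for S
    by (simp add: topology_of_def topology_inverse' [OF ist'])
  show "lim_pullback (topology_of (shadows \<A>)) (topology_of \<A>)"
  proof
    show "topspace (topology_of (shadows \<A>)) = UNIV"
      using Un' by (simp add: topspace_def open_T)
    show "openin (topology_of \<A>) A \<longleftrightarrow>
        (\<exists>S. openin (topology_of (shadows \<A>)) S \<and> A = lim_vimage S)" for A
      using \<A> by (auto simp: open_hT open_T mem_shadows_iff [OF \<A>])
  qed
qed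

theorem proposition4p8:
  shows
    "(\<forall>hX hB. hX \<subseteq> hatR \<and> is_base_for_topology_for hB hX \<and> hB \<subseteq> monads_of_real_sets
        \<longrightarrow> is_base_for_topology_for (shadows hB) (shadow hX))
   \<and> (\<forall>hC. is_topology_for hC hatR \<and> hC \<subseteq> monads_of_real_sets \<longrightarrow>
        (let C = shadows hC; hT = topology_of hC; T = topology_of C in
          is_topology_for C (UNIV :: real set)
        \<and> (\<forall>hX \<in> monads_of_real_sets.
              T interior_of (shadow hX) = shadow (hT interior_of hX)
            \<and> T exterior_of (shadow hX) = shadow (hT exterior_of hX)
            \<and> T frontier_of (shadow hX) = shadow (hT frontier_of hX)
            \<and> T closure_of (shadow hX) = shadow (hT closure_of hX)
            \<and> (openin T (shadow hX) \<longleftrightarrow> openin hT hX)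
            \<and> (closedin T (shadow hX) \<longleftrightarrow> closedin hT hX)
            \<and> (compactin T (shadow hX) \<longleftrightarrow> compactin hT hX))
        \<and> (\<forall>hX hY. hY \<subseteq> hX \<and> hX \<subseteq> hatR \<and> hX \<in> monads_of_hat_sets \<and> hY \<in> monads_of_hat_sets \<longrightarrow>
              {U. openin (subtopology T (shadow hX)) U} =
                shadows {A. openin (subtopology hT hX) A}
            \<and> (subtopology T (shadow hX)) closure_of (shadow hY) =
                shadow ((subtopology hT hX) closure_of hY))
        \<and> (\<forall>hX \<in> monads_of_real_sets. connectedin T (shadow hX) \<longleftrightarrow> connectedin hT hX)))
   \<and> (\<forall>hB. sigma_algebra hatR hB \<and> hB \<subseteq> monads_of_real_sets
        \<longrightarrow> sigma_algebra (UNIV :: real set) (shadows hB))"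
    (is "_ \<and> (\<forall>hC. _ \<longrightarrow> ?topological_part hC) \<and> _")
proof (intro conjI allI impI; (elim conjE)?)
  fix hX hB
  assume "is_base_for_topology_for hB hX" "hB \<subseteq> monads_of_real_sets"
  then show "is_base_for_topology_for (shadows hB) (shadow hX)"
    by (intro base_shadows) (simp_all add: monads_of_real_sets_eq)
next
  fix hB
  assume "sigma_algebra hatR hB" "hB \<subseteq> monads_of_real_sets"
  then show "sigma_algebra UNIV (shadows hB)"
    by (intro sigma_algebra_shadows) (simp_all add: monads_of_real_sets_eq)
next
  fix hC
  assume hC: "is_topology_for hC hatR" "hC \<subseteq> monads_of_real_sets"
  note hC' = hC [unfolded monads_of_real_sets_eq]
  interpret lim_pullback "topology_of (shadows hC)" "topology_of hC"
    by (rule topology_shadows(2) [OF hC'])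
  \<comment> \<open>Each monad is written as \<open>lim_vimage S\<close> with shadow
    \<open>S\<close>; the transfer lemmas move \<open>lim_vimage\<close> outside each operator,
    where \<open>shadow\<close> cancels it.\<close>
  show "?topological_part hC"
    unfolding Let_def monads_of_real_sets_eq monads_of_hat_sets_eq
    using topology_shadows(1) [OF hC']
    by (auto simp: interior_of_lim_vimage exterior_of_lim_vimage frontier_of_lim_vimage
        closure_of_lim_vimage compactin_lim_vimage_iff connectedin_lim_vimage_iff
        openin_subtopology_shadows closure_of_subtopology_lim_vimage)
qed

end
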